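(* Let $X=\{x_{1},\ldots,x_{l}\}$ and $Y=\{-y_{1},\ldots,-y_{m}\}$ be disjoint nonempty sets of even integers, where $x_{1}>\cdots>x_{l}$ are non-negative even integers and $y_{1}<\cdots<y_{m}$ are positive even integers, and suppose $X\cup Y\neq\{0\}$. Let $L=\sum_{i=1}^{l}x_{i}$, $M=\sum_{i=1}^{m}y_{i}$ and $n=lM+mL$. (i) If $0\in X\cup Y$, then there exists a tournament of order $n+1$ with imbalance set $X\cup Y$. (ii) If there exist $x_{p}\in X$ and (not necessarily distinct) $-y_{q},-y_{r}\in Y$ such that $x_{p}=y_{q}+y_{r}$, then there exists a tournament of order $n+3$ with imbalance set $X\cup Y$. (iii) If there exist $-y_{p}\in Y$ and (not necessarily distinct) $x_{q},x_{r}\in X$ such that $y_{p}=x_{q}+x_{r}$, then there exists a tournament of order $n+3$ with imbalance set $X\cup Y$.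
   Context: A tournament is an orientation of a complete simple graph; its order is its number of vertices. The imbalance of a vertex $v$ in a digraph is $d^{+}(v)-d^{-}(v)$ (outdegree minus indegree), and the imbalance set of a digraph is the set of imbalances of its vertices.
   Formalization: The condition X ≠ {0} is added: for X={0}, Y={-2} part (i) as printed fails, since the imbalances of a tournament sum to 0; when X={0} part (i) always fails and the premises of (ii) and (iii) cannot hold. *)

theory Defs
  imports "Graph_Theory.Graph_Theory"
begin

text \<open>As in the library, an undirected simple graph is a symmetric digraph (locale \<^locale>\<open>graph\<close>),
  each edge being represented by the pair of opposite arcs.\<close>

definition orientation_of :: "('a, 'b) pre_digraph \<Rightarrow> ('a, 'c) pre_digraph \<Rightarrow> bool" where
  "orientation_of T G \<longleftrightarrow> digraph T \<and> graph G \<and> verts T = verts G \<and>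
     arcs_ends T \<subseteq> arcs_ends G \<and>
     (\<forall>u v. (u, v) \<in> arcs_ends G \<longrightarrow> ((u, v) \<in> arcs_ends T \<longleftrightarrow> (v, u) \<notin> arcs_ends T))"

definition tournament :: "('a, 'b) pre_digraph \<Rightarrow> bool" where
  "tournament T \<longleftrightarrow>
     (\<exists>n. \<exists>G :: ('a, 'a \<times> 'a) pre_digraph. complete_digraph n G \<and> orientation_of T G)"

definition imbalance :: "('a, 'b) pre_digraph \<Rightarrow> 'a \<Rightarrow> int" where
  "imbalance G v = int (out_degree G v) - int (in_degree G v)"

definition imbalance_set :: "('a, 'b) pre_digraph \<Rightarrow> int set" where
  "imbalance_set G = imbalance G ` verts G"

lemma tournament_iff:
  "tournament T \<longleftrightarrow> digraph T \<and>
     (\<forall>u \<in> verts T. \<forall>v \<in> verts T. u \<noteq> v \<longrightarrow>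
        ((u, v) \<in> arcs_ends T \<longleftrightarrow> (v, u) \<notin> arcs_ends T))" (is "_ \<longleftrightarrow> ?R")
proof
  assume "tournament T"
  then obtain n and G :: "('a, 'a \<times> 'a) pre_digraph"
    where "complete_digraph n G" "orientation_of T G"
    unfolding tournament_def by blast
  then show ?R
    unfolding orientation_of_def complete_digraph_def by blast
next
  assume R: ?R
  then interpret T: digraph T by blast
  define G :: "('a, 'a \<times> 'a) pre_digraph" where
    "G = \<lparr>verts = verts T, arcs = {(u, v). u \<in> verts T \<and> v \<in> verts T \<and> u \<noteq> v},
          tail = fst, head = snd\<rparr>"
  have ends: "arcs_ends G = {(u, v). (u, v) \<in> verts T \<times> verts T \<and> u \<noteq> v}"
    by (auto simp: G_def arcs_ends_def arc_to_ends_def)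
  have "finite (arcs G)"
    by (rule finite_subset[of _ "verts T \<times> verts T"]) (auto simp: G_def)
  then have G: "graph G"
    by unfold_locales
      (simp_all add: ends symmetric_def sym_def, auto simp: G_def arc_to_ends_def)
  have "arcs_ends T \<subseteq> arcs_ends G"
    using T.adj_in_verts T.adj_not_same by (auto simp: ends)
  moreover have "verts T = verts G"
    by (simp add: G_def)
  ultimately have "orientation_of T G"
    using R G unfolding orientation_of_def ends by blast
  moreover have "complete_digraph (card (verts T)) G"
    using G ends by (simp add: complete_digraph_def G_def)
  ultimately show "tournament T"
    unfolding tournament_def by blast
qed

end

theory Submission
  imports Defs
begin

text \<open>
  List every element of \<open>X\<close> exactly \<open>M\<close> times and every element of \<open>Y\<close> exactly \<open>L\<close> times, and append
  \<open>0\<close>, or the three numbers \<open>x\<^sub>p, -y\<^sub>q, -y\<^sub>r\<close> (resp. \<open>-y\<^sub>p, x\<^sub>q, x\<^sub>r\<close>): this is a list of even numbers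
  of odd length with sum zero. All entries lie between \<open>-M\<close> and \<open>L\<close>, and \<open>L + M\<close> is at most the
  length \<open>N\<close> of the list. For a set of \<open>k\<close> entries, either \<open>M \<le> N - k\<close>, or \<open>L \<le> k\<close> and one passes to the
  complement; in both cases its sum is at least \<open>-k (N - k)\<close>. So Landau's condition holds and the
  list consists of the imbalances of a tournament.

  Landau's theorem follows by path reversal: reversing a path from a vertex whose imbalance is
  too large to one whose imbalance is too small corrects both. If no such path leaves a
  vertex of too large imbalance, then the set of vertices reachable from it violates the condition.
\<close>

section \<open>Tournaments as skew-symmetric sign matrices\<close>

text \<open>The entry \<open>s u v\<close> is \<open>1\<close> if the arc goes from \<open>u\<close> to \<open>v\<close> and \<open>-1\<close> if it goes from \<open>v\<close> to \<open>u\<close>; the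
  imbalance of \<open>v\<close> is the row sum \<open>sum (s v) V\<close>. Entries outside \<open>V \<times> V\<close> carry no meaning.\<close>

definition tournament_matrix :: "'a set \<Rightarrow> ('a \<Rightarrow> 'a \<Rightarrow> int) \<Rightarrow> bool" where
  "tournament_matrix V s \<longleftrightarrow>
     (\<forall>u v. s v u = - s u v) \<and> (\<forall>u \<in> V. \<forall>v \<in> V. u \<noteq> v \<longrightarrow> \<bar>s u v\<bar> = 1)"

lemma tournament_matrix_skew: "tournament_matrix V s \<Longrightarrow> s v u = - s u v"
  unfolding tournament_matrix_def by blast

lemma tournament_matrix_cases:
  assumes "tournament_matrix V s" "u \<in> V" "v \<in> V" "u \<noteq> v"
  shows "s u v = 1 \<or> s u v = -1"
proof -
  have "\<bar>s u v\<bar> = 1"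
    using assms unfolding tournament_matrix_def by blast
  then show ?thesis by linarith
qed

lemma tournament_matrix_diag: "tournament_matrix V s \<Longrightarrow> s v v = 0"
  using tournament_matrix_skew[of V s v v] by simp

text \<open>Path reversal starts from the transitive tournament given by an injection into the
  natural numbers.\<close>

lemma tournament_matrix_exists:
  assumes "finite V"
  shows "\<exists>s. tournament_matrix V s"
proof -
  obtain f :: "'a \<Rightarrow> nat" where "inj_on f V"
    using finite_imp_inj_to_nat_seg[OF assms] by blast
  then have "tournament_matrix V (\<lambda>u v. sgn (int (f u) - int (f v)))"
    by (auto simp: tournament_matrix_def sgn_if inj_on_def)
  then show ?thesis by blast
qed

lemma tournament_matrix_sum_zero:
  assumes "tournament_matrix V s"
  shows "(\<Sum>u\<in>R. \<Sum>v\<in>R. s u v) = 0"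
proof -
  have "(\<Sum>u\<in>R. \<Sum>v\<in>R. s u v) = (\<Sum>u\<in>R. \<Sum>v\<in>R. s v u)"
    by (rule sum.swap)
  also have "\<dots> = - (\<Sum>u\<in>R. \<Sum>v\<in>R. s u v)"
    unfolding sum_negf[symmetric] by (intro sum.cong refl tournament_matrix_skew[OF assms])
  finally show ?thesis by simp
qed

text \<open>A row has \<open>card V - 1\<close> odd entries besides its diagonal zero. Hence
  deviations from a target of the right parity are even, and a correction by 2 never
  overshoots.\<close>

lemma tournament_matrix_row_parity:
  assumes "tournament_matrix V s" "finite V" "v \<in> V"
  shows "even (sum (s v) V + int (card V) + 1)"
proof -
  have "even (\<Sum>w\<in>V - {v}. s v w + 1)"
    by (rule dvd_sum) (use tournament_matrix_cases[OF assms(1,3)] in fastforce)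
  moreover have "sum (s v) V = sum (s v) (V - {v})"
    using assms by (simp add: sum.remove[of V v] tournament_matrix_diag)
  moreover have "card V = Suc (card (V - {v}))"
    using card_Suc_Diff1[OF assms(2,3)] by simp
  ultimately show ?thesis
    by (simp add: sum.distrib)
qed

section \<open>Path reversal\<close>

lemma rtranclp_imp_distinct_path:
  assumes "r\<^sup>*\<^sup>* u v"
  shows "\<exists>xs. xs \<noteq> [] \<and> distinct xs \<and> hd xs = u \<and> last xs = v \<and> successively r xs"
  using assms
proof (induction rule: converse_rtranclp_induct)
  case base
  show ?case by (rule exI[of _ "[v]"]) simp
next
  case (step u w)
  then obtain xs where xs: "xs \<noteq> []" "distinct xs" "hd xs = w" "last xs = v" "successively r xs"
    by blast
  show ?case
  proof (cases "u \<in> set xs")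
    \<comment> \<open>If \<open>u\<close> already occurs on the path, the detour before it is
      dropped.\<close>
    case True
    then obtain ys zs where "xs = ys @ u # zs" by (meson split_list)
    with xs show ?thesis
      by (intro exI[of _ "u # zs"]) (auto simp: successively_append_iff)
  next
    case False
    with xs step.hyps(1) show ?thesis
      by (intro exI[of _ "u # xs"]) (auto simp: successively_Cons)
  qed
qed

text \<open>Reversing an arc from \<open>a\<close> to \<open>b\<close> lowers the row sum of
  \<open>a\<close> by 2 and raises that of \<open>b\<close> by 2, so the changes cancel at inner
  vertices. The induction reverses the first arc and then the remaining path.\<close>

lemma tournament_matrix_reverse_path:
  assumes "tournament_matrix V s" "finite V" "xs \<noteq> []" "distinct xs"
    and "successively (\<lambda>a b. a \<in> V \<and> b \<in> V \<and> s a b = 1) xs"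
  shows "\<exists>s'. tournament_matrix V s' \<and>
    (\<forall>a. sum (s' a) V = sum (s a) V - (if a = hd xs then 2 else 0) + (if a = last xs then 2 else 0))"
  using assms
proof (induction xs arbitrary: s)
  case Nil
  then show ?case by simp
next
  case (Cons u xs)
  show ?case
  proof (cases "xs = []")
    case True
    with Cons.prems show ?thesis by (intro exI[of _ s]) auto
  next
    case False
    define w where "w = hd xs"
    have w: "w \<in> set xs" using False by (simp add: w_def)
    then have "u \<noteq> w" using Cons.prems(4) by auto
    have uw: "u \<in> V" "w \<in> V" "s u w = 1"
      and succ: "successively (\<lambda>a b. a \<in> V \<and> b \<in> V \<and> s a b = 1) xs"
      using Cons.prems(5) False by (auto simp: successively_Cons w_def)
    define t where "t a b = s a b - (if a = u \<and> b = w then 2 else 0)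
      + (if a = w \<and> b = u then 2 else 0)" for a b
    have t: "tournament_matrix V t"
      unfolding tournament_matrix_def
    proof (intro conjI allI ballI impI)
      fix a b
      show "t b a = - t a b"
        unfolding t_def tournament_matrix_skew[OF Cons.prems(1), of b a]
          conj_commute[of "b = u"] conj_commute[of "b = w"] by linarith
    next
      fix a b assume "a \<in> V" "b \<in> V" "a \<noteq> b"
      then have "\<bar>s a b\<bar> = 1"
        using tournament_matrix_cases[OF Cons.prems(1)] by fastforce
      moreover have "s w u = -1"
        using uw(3) tournament_matrix_skew[OF Cons.prems(1), of w u] by linarith
      ultimately show "\<bar>t a b\<bar> = 1"
        using uw(3) \<open>u \<noteq> w\<close> by (auto simp: t_def)
    qed
    have row: "sum (t a) V = sum (s a) V - (if a = u then 2 else 0) + (if a = w then 2 else 0)" for a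
      using Cons.prems(2) uw \<open>u \<noteq> w\<close>
      by (cases "a = u"; cases "a = w") (simp_all add: t_def sum.distrib sum_subtractf)
    \<comment> \<open>The reversed arc is incident with \<open>u\<close>, which \<open>xs\<close>
      avoids by distinctness, so \<open>xs\<close> is still a path for \<open>t\<close>.\<close>
    have "successively (\<lambda>a b. a \<in> V \<and> b \<in> V \<and> t a b = 1) xs"
      using succ
    proof (rule successively_mono)
      fix a b assume ab: "a \<in> set xs" "b \<in> set xs" "a \<in> V \<and> b \<in> V \<and> s a b = 1"
      then have "a \<noteq> u" "b \<noteq> u" using Cons.prems(4) by auto
      with ab(3) show "a \<in> V \<and> b \<in> V \<and> t a b = 1" by (simp add: t_def)
    qed
    moreover have "distinct xs" using Cons.prems(4) by simp
    ultimately obtain s' where s': "tournament_matrix V s'" and row':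
      "\<And>a. sum (s' a) V = sum (t a) V - (if a = w then 2 else 0) + (if a = last xs then 2 else 0)"
      using Cons.IH[OF t Cons.prems(2) False] unfolding w_def by blast
    have "sum (s' a) V = sum (s a) V - (if a = hd (u # xs) then 2 else 0)
        + (if a = last (u # xs) then 2 else 0)" for a
      using False by (simp add: row' row)
    with s' show ?thesis by blast
  qed
qed

section \<open>Landau's theorem for imbalances\<close>

text \<open>No arc leaves \<open>R\<close>, so each pair in \<open>R\<close> times
  \<open>V - R\<close> contributes -1, while the entries inside \<open>R\<close> cancel. This is
  equality in Landau's condition.\<close>

lemma tournament_matrix_closed_set_sum:
  assumes "tournament_matrix V s" "finite V" "R \<subseteq> V"
    and closed: "\<And>a b. a \<in> R \<Longrightarrow> b \<in> V \<Longrightarrow> s a b = 1 \<Longrightarrow> b \<in> R"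
  shows "(\<Sum>a\<in>R. sum (s a) V) = - int (card R * (card V - card R))"
proof -
  have fin: "finite R" using assms finite_subset by blast
  have "sum (s a) V = sum (s a) R - int (card V - card R)" if "a \<in> R" for a
  proof -
    have "sum (s a) (V - R) = (\<Sum>b\<in>V - R. -1)"
      using tournament_matrix_cases[OF assms(1), of a] closed[OF that] that assms(3)
      by (intro sum.cong) auto
    moreover have "sum (s a) V = sum (s a) (V - R) + sum (s a) R"
      using assms by (intro sum.subset_diff) auto
    ultimately show ?thesis
      using assms(3) fin by (simp add: card_Diff_subset)
  qed
  then have "(\<Sum>a\<in>R. sum (s a) V) = (\<Sum>a\<in>R. sum (s a) R) - int (card R * (card V - card R))"
    by (simp add: sum_subtractf)
  then show ?thesis
    using tournament_matrix_sum_zero[OF assms(1)] by simp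
qed

theorem landau_imbalance:
  fixes b :: "'a \<Rightarrow> int"
  assumes fin: "finite V"
    and parity: "\<And>v. v \<in> V \<Longrightarrow> even (b v + int (card V) + 1)"
    and total: "sum b V = 0"
    and landau: "\<And>S. S \<subseteq> V \<Longrightarrow> - int (card S * (card V - card S)) \<le> sum b S"
  shows "\<exists>s. tournament_matrix V s \<and> (\<forall>v \<in> V. sum (s v) V = b v)"
proof -
  have "\<exists>s'. tournament_matrix V s' \<and> (\<forall>v \<in> V. sum (s' v) V = b v)"
    if "tournament_matrix V s" for s
    using that
  \<comment> \<open>The measure is the total deviation from the prescribed imbalances.\<close>
  proof (induction "nat (\<Sum>v\<in>V. \<bar>sum (s v) V - b v\<bar>)" arbitrary: s rule: less_induct)
    case less
    define d where "d v = sum (s v) V - b v" for v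
    define r where "r = (\<lambda>a b. a \<in> V \<and> b \<in> V \<and> s a b = 1)"
    have d_sum: "sum d V = 0"
      using tournament_matrix_sum_zero[OF less.prems] total
      by (simp add: d_def sum_subtractf)
    show ?case
    proof (cases "\<forall>v\<in>V. d v = 0")
      case True
      then show ?thesis using less.prems by (auto simp: d_def)
    next
      case False
      have "\<exists>u\<in>V. d u > 0"
      proof (rule ccontr)
        assume "\<not> (\<exists>u\<in>V. d u > 0)"
        then have "\<forall>v\<in>V. d v = 0"
          using sum_nonneg_eq_0_iff[OF fin, of "\<lambda>v. - d v"] d_sum
          by (auto simp: not_less sum_negf)
        with False show False by blast
      qed
      then obtain u where u: "u \<in> V" "d u > 0" by blast
      define R where "R = {v. r\<^sup>*\<^sup>* u v}"
      have RV: "R \<subseteq> V"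
      proof
        fix v assume "v \<in> R"
        then have "r\<^sup>*\<^sup>* u v" by (simp add: R_def)
        then show "v \<in> V" using u(1) by induction (auto simp: r_def)
      qed
      have "\<exists>v\<in>R. d v < 0"
      proof (rule ccontr)
        assume "\<not> (\<exists>v\<in>R. d v < 0)"
        \<comment> \<open>The row sums over \<open>R\<close> would then exceed the prescribed sum,
          although they attain the least value that \<open>landau\<close> allows for it.\<close>
        then have "sum d R > 0"
          using u RV fin by (intro sum_pos2[of R u]) (auto simp: R_def not_less dest: finite_subset)
        moreover have "b' \<in> R" if "a \<in> R" "b' \<in> V" "s a b' = 1" for a b'
          using that RV by (auto simp: R_def r_def intro: rtranclp.rtrancl_into_rtrancl)
        then have "(\<Sum>a\<in>R. sum (s a) V) = - int (card R * (card V - card R))"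
          by (rule tournament_matrix_closed_set_sum[OF less.prems fin RV])
        ultimately show False
          using landau[OF RV] by (simp add: d_def sum_subtractf)
      qed
      then obtain v where v: "v \<in> R" "d v < 0" by blast
      then have "r\<^sup>*\<^sup>* u v" by (simp add: R_def)
      then obtain xs where xs: "xs \<noteq> []" "distinct xs" "hd xs = u" "last xs = v" "successively r xs"
        using rtranclp_imp_distinct_path by metis
      obtain s' where s': "tournament_matrix V s'"
        "\<And>a. sum (s' a) V = sum (s a) V - (if a = u then 2 else 0) + (if a = v then 2 else 0)"
        using tournament_matrix_reverse_path[OF less.prems fin xs(1,2)] xs(3-5)
        unfolding r_def by auto
      have even_d: "even (d a)" if "a \<in> V" for a
        using tournament_matrix_row_parity[OF less.prems fin that] parity[OF that]
        by (auto simp: d_def)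
      have le2: "d u \<ge> 2"
        using u even_d[of u] by presburger
      \<comment> \<open>Only \<open>u\<close> and \<open>v\<close> change. As \<open>d u\<close> is
        at least 2 and \<open>d v\<close> at most -2, each absolute deviation drops by 2.\<close>
      have "(\<Sum>a\<in>V. \<bar>sum (s' a) V - b a\<bar>) < (\<Sum>a\<in>V. \<bar>d a\<bar>)"
      proof (rule sum_strict_mono_ex1[OF fin])
        have "v \<in> V" using v RV by blast
        then have "d v \<le> -2" using v even_d[of v] by presburger
        with le2 show "\<forall>a\<in>V. \<bar>sum (s' a) V - b a\<bar> \<le> \<bar>d a\<bar>"
          by (auto simp: s'(2) d_def)
        show "\<exists>a\<in>V. \<bar>sum (s' a) V - b a\<bar> < \<bar>d a\<bar>"
          using le2 u(1) v(2) by (intro bexI[of _ u]) (auto simp: s'(2) d_def)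
      qed
      moreover have "0 \<le> (\<Sum>a\<in>V. \<bar>sum (s' a) V - b a\<bar>)"
        by (simp add: sum_nonneg)
      ultimately show ?thesis
        by (intro less.hyps[OF _ s'(1)]) (simp only: d_def nat_less_eq_zless)
    qed
  qed
  with tournament_matrix_exists[OF fin] show ?thesis by blast
qed

section \<open>From matrices to digraphs\<close>

lemma tournament_matrix_imp_tournament:
  assumes s: "tournament_matrix V s" and fin: "finite V"
  defines "T \<equiv> \<lparr>verts = V, arcs = {(u, v). u \<in> V \<and> v \<in> V \<and> s u v = 1}, tail = fst, head = snd\<rparr>"
  shows "tournament T"
    and "\<And>v. v \<in> V \<Longrightarrow> imbalance T v = sum (s v) V"
proof -
  have fa: "finite (arcs T)"
    by (rule finite_subset[of _ "V \<times> V"]) (auto simp: T_def fin)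
  have "digraph T"
    using fa fin tournament_matrix_diag[OF s]
    by unfold_locales (auto simp: T_def arc_to_ends_def)
  moreover have ends: "arcs_ends T = {(u, v). u \<in> V \<and> v \<in> V \<and> s u v = 1}"
    by (auto simp: T_def arcs_ends_def arc_to_ends_def)
  moreover have "s u v = 1 \<longleftrightarrow> s v u \<noteq> 1" if "u \<in> V" "v \<in> V" "u \<noteq> v" for u v
    using tournament_matrix_cases[OF s that] tournament_matrix_skew[OF s, of v u] by auto
  moreover have "verts T = V"
    by (simp add: T_def)
  ultimately show "tournament T"
    unfolding tournament_iff by blast
  fix v assume v: "v \<in> V"
  have skew: "s w v = 1 \<longleftrightarrow> s v w = -1" for w
    using tournament_matrix_skew[OF s, of w v] by auto
  have "out_arcs T v = Pair v ` {w \<in> V. s v w = 1}" "in_arcs T v = (\<lambda>w. (w, v)) ` {w \<in> V. s v w = -1}"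
    using v by (auto simp: T_def out_arcs_def in_arcs_def skew)
  then have "out_degree T v = card {w \<in> V. s v w = 1}" "in_degree T v = card {w \<in> V. s v w = -1}"
    by (simp_all add: out_degree_def in_degree_def card_image inj_on_def)
  \<comment> \<open>The two indicators count out- and in-neighbours; the diagonal entry 0 counts as
    neither.\<close>
  moreover have "sum (s v) V = (\<Sum>w\<in>V. (if s v w = 1 then 1 else 0) - (if s v w = -1 then 1 else 0))"
  proof (intro sum.cong refl)
    fix w assume "w \<in> V"
    then show "s v w = (if s v w = 1 then 1 else 0) - (if s v w = -1 then 1 else 0)"
      using tournament_matrix_cases[OF s v] tournament_matrix_diag[OF s, of v] by (cases "v = w") force+
  qed
  ultimately show "imbalance T v = sum (s v) V"
    using fin by (simp add: imbalance_def sum_subtractf sum.If_cases Int_def)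
qed

section \<open>Realising a bounded list of even numbers\<close>

lemma bounded_sum_zero_landau:
  fixes b :: "'a \<Rightarrow> int"
  assumes "finite V" "sum b V = 0" "A + B \<le> card V"
    and bd: "\<And>v. v \<in> V \<Longrightarrow> - int B \<le> b v \<and> b v \<le> int A"
    and "S \<subseteq> V"
  shows "- int (card S * (card V - card S)) \<le> sum b S"
proof (cases "B \<le> card V - card S")
  case True
  have "- int (card S * (card V - card S)) \<le> - int (card S * B)"
    using True by (simp del: of_nat_mult)
  also have "\<dots> = (\<Sum>v\<in>S. - int B)" by simp
  also have "\<dots> \<le> sum b S"
    using bd \<open>S \<subseteq> V\<close> by (intro sum_mono) auto
  finally show ?thesis .
next
  case False
  have fin: "finite S" using assms finite_subset by blast
  \<comment> \<open>Here \<open>A\<close> is at most \<open>card S\<close>. An upper bound on the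
    complement suffices, since its sum is the negative of \<open>sum b S\<close>.\<close>
  have "sum b (V - S) \<le> (\<Sum>v\<in>V - S. int A)"
    using bd by (intro sum_mono) auto
  also have "\<dots> = int ((card V - card S) * A)"
    using \<open>S \<subseteq> V\<close> fin by (simp add: card_Diff_subset)
  also have "\<dots> \<le> int ((card V - card S) * card S)"
    using False assms(3) by (intro of_nat_mono mult_le_mono) auto
  finally show ?thesis
    using sum.subset_diff[OF \<open>S \<subseteq> V\<close> \<open>finite V\<close>, of b] assms(2) by (simp add: mult.commute)
qed

lemma tournament_of_imbalance_list:
  assumes "sum_list bs = 0" "odd (length bs)" "A + B \<le> length bs"
    and "\<And>e. e \<in> set bs \<Longrightarrow> even e \<and> - int B \<le> e \<and> e \<le> int A"
  shows "\<exists>T :: (nat, nat \<times> nat) pre_digraph.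
    tournament T \<and> card (verts T) = length bs \<and> imbalance_set T = set bs"
proof -
  let ?V = "{0..<length bs}"
  have tot: "sum ((!) bs) ?V = 0"
    using assms(1) by (simp add: sum_list_sum_nth)
  have bd: "even (bs ! i) \<and> - int B \<le> bs ! i \<and> bs ! i \<le> int A" if "i \<in> ?V" for i
    using assms(4) that by simp
  have "\<exists>s. tournament_matrix ?V s \<and> (\<forall>v \<in> ?V. sum (s v) ?V = bs ! v)"
  proof (rule landau_imbalance)
    show "- int (card S * (card ?V - card S)) \<le> sum ((!) bs) S" if "S \<subseteq> ?V" for S
      using bd assms(3) by (intro bounded_sum_zero_landau[OF _ tot _ _ that]) auto
  \<comment> \<open>Parity holds because the entries are even and their number is odd.\<close>
  qed (use tot bd assms(2) in auto)
  then obtain s where s: "tournament_matrix ?V s" "\<And>v. v \<in> ?V \<Longrightarrow> sum (s v) ?V = bs ! v"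
    by blast
  define T where "T = \<lparr>verts = ?V, arcs = {(u, v). u \<in> ?V \<and> v \<in> ?V \<and> s u v = 1},
    tail = fst, head = snd\<rparr>"
  have "tournament T" and "\<And>v. v \<in> ?V \<Longrightarrow> imbalance T v = bs ! v"
    using tournament_matrix_imp_tournament[OF s(1)] s(2) unfolding T_def by auto
  moreover have "verts T = ?V" by (simp add: T_def)
  moreover have "(!) bs ` ?V = set bs"
    by (auto simp: in_set_conv_nth)
  ultimately have "imbalance_set T = set bs"
    unfolding imbalance_set_def by (metis image_cong)
  with \<open>tournament T\<close> \<open>verts T = ?V\<close> show ?thesis by auto
qed

lemma sum_list_concat_replicate: "sum_list (concat (replicate k xs)) = int k * sum_list xs"
  by (induction k) (simp_all add: distrib_right)

section \<open>The lists for the three cases\<close>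

theorem theorem3p3:
  fixes l m L M n :: nat
    and x y :: "nat \<Rightarrow> nat"
    and X Y :: "int set"
  assumes X_def: "X = (\<lambda>i. int (x i)) ` {1..l}"
    and Y_def: "Y = (\<lambda>i. - int (y i)) ` {1..m}"
    and "X \<noteq> {}" and "Y \<noteq> {}"
    and "X \<inter> Y = {}"
    and "strict_antimono_on {1..l} x" and "\<And>i. i \<in> {1..l} \<Longrightarrow> even (x i)"
    and "strict_mono_on {1..m} y" and "\<And>i. i \<in> {1..m} \<Longrightarrow> even (y i) \<and> y i > 0"
    and "X \<union> Y \<noteq> {0}"
    and "X \<noteq> {0}"
    and L_def: "L = (\<Sum>i = 1..l. x i)"
    and M_def: "M = (\<Sum>i = 1..m. y i)"
    and n_def: "n = l * M + m * L"
  shows "(0 \<in> X \<union> Y \<longrightarrow>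
            (\<exists>T :: (nat, nat \<times> nat) pre_digraph.
               tournament T \<and> card (verts T) = n + 1 \<and> imbalance_set T = X \<union> Y)) \<and>
         ((\<exists>p \<in> {1..l}. \<exists>q \<in> {1..m}. \<exists>r \<in> {1..m}. x p = y q + y r) \<longrightarrow>
            (\<exists>T :: (nat, nat \<times> nat) pre_digraph.
               tournament T \<and> card (verts T) = n + 3 \<and> imbalance_set T = X \<union> Y)) \<and>
         ((\<exists>p \<in> {1..m}. \<exists>q \<in> {1..l}. \<exists>r \<in> {1..l}. y p = x q + x r) \<longrightarrow>
            (\<exists>T :: (nat, nat \<times> nat) pre_digraph.
               tournament T \<and> card (verts T) = n + 3 \<and> imbalance_set T = X \<union> Y))"
proof -
  define xs where "xs = map (\<lambda>i. int (x i)) [1..<Suc l]"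
  define ys where "ys = map (\<lambda>i. - int (y i)) [1..<Suc m]"
  \<comment> \<open>The multiplicities balance the sums, \<open>M * L\<close> against
    \<open>L * M\<close>, and give length \<open>l * M + m * L = n\<close>.\<close>
  define bs where "bs = concat (replicate M xs) @ concat (replicate L ys)"
  have set_xs: "set xs = X" and set_ys: "set ys = Y"
    unfolding xs_def ys_def X_def Y_def by (simp_all add: atLeastLessThanSuc_atLeastAtMost del: upt_Suc)
  have sums: "sum_list xs = int L" "sum_list ys = - int M"
    unfolding xs_def ys_def L_def M_def
    by (simp_all add: sum_set_upt_conv_sum_list_nat[symmetric]
      atLeastLessThanSuc_atLeastAtMost sum_negf del: upt_Suc)
  have lm: "l \<ge> 1" "m \<ge> 1"
    using \<open>X \<noteq> {}\<close> \<open>Y \<noteq> {}\<close> X_def Y_def by auto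
  have xL: "x i \<le> L" if "i \<in> {1..l}" for i
    unfolding L_def using that by (intro member_le_sum) auto
  have yM: "y i \<le> M" if "i \<in> {1..m}" for i
    unfolding M_def using that by (intro member_le_sum) auto
  have "M > 0"
    using yM[of 1] assms(9)[of 1] lm by auto
  \<comment> \<open>With \<open>L = 0\<close> the list \<open>bs\<close> would contain no element of
    \<open>Y\<close>; likewise \<open>M > 0\<close> ensures that \<open>X\<close> occurs.\<close>
  have "L > 0"
  proof (rule ccontr)
    assume "\<not> L > 0"
    with xL have "X \<subseteq> {0}" by (auto simp: X_def)
    with \<open>X \<noteq> {}\<close> \<open>X \<noteq> {0}\<close> show False by blast
  qed
  have sum_bs: "sum_list bs = 0"
    by (simp add: bs_def sum_list_concat_replicate sums)
  have len_bs: "length bs = n"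
    by (simp add: bs_def n_def length_concat sum_list_replicate xs_def ys_def)
  have set_bs: "set bs = X \<union> Y"
    using \<open>L > 0\<close> \<open>M > 0\<close> by (simp add: bs_def set_xs set_ys)
  have "even L" "even M"
    unfolding L_def M_def using assms(7,9) by (auto intro!: dvd_sum)
  then have "even n" by (simp add: n_def)
  have "1 * M \<le> l * M" "1 * L \<le> m * L"
    using lm by (intro mult_le_mono1; simp)+
  then have LMn: "L + M \<le> n"
    unfolding n_def by linarith
  have bd: "even e \<and> - int M \<le> e \<and> e \<le> int L" if "e \<in> X \<union> Y" for e
    using that xL yM assms(7,9) by (fastforce simp: X_def Y_def)
  \<comment> \<open>Since \<open>n\<close> is even, an appended block \<open>cs\<close> of odd
    length makes the order odd; having sum zero and entries from \<open>X \<union> Y\<close>, it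
    preserves the total and the set of values.\<close>
  have ext: "\<exists>T :: (nat, nat \<times> nat) pre_digraph.
      tournament T \<and> card (verts T) = n + length cs \<and> imbalance_set T = X \<union> Y"
    if "sum_list cs = 0" "odd (length cs)" "set cs \<subseteq> X \<union> Y" for cs
  proof -
    have "set (bs @ cs) = X \<union> Y" using that set_bs by auto
    then show ?thesis
      using tournament_of_imbalance_list[of "bs @ cs" L M] that sum_bs len_bs \<open>even n\<close> LMn bd
      by auto
  qed
  show ?thesis
  proof (intro conjI impI)
    assume "0 \<in> X \<union> Y"
    then show "\<exists>T :: (nat, nat \<times> nat) pre_digraph.
        tournament T \<and> card (verts T) = n + 1 \<and> imbalance_set T = X \<union> Y"
      using ext[of "[0]"] by simp
  next
    assume "\<exists>p \<in> {1..l}. \<exists>q \<in> {1..m}. \<exists>r \<in> {1..m}. x p = y q + y r"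
    then obtain p q r where "p \<in> {1..l}" "q \<in> {1..m}" "r \<in> {1..m}" "x p = y q + y r"
      by blast
    then have "int (x p) \<in> X" "- int (y q) \<in> Y" "- int (y r) \<in> Y" "sum_list [int (x p), - int (y q), - int (y r)] = 0"
      unfolding X_def Y_def by (blast, blast, blast, simp)
    then show "\<exists>T :: (nat, nat \<times> nat) pre_digraph.
        tournament T \<and> card (verts T) = n + 3 \<and> imbalance_set T = X \<union> Y"
      using ext[of "[int (x p), - int (y q), - int (y r)]"] by (simp add: numeral_3_eq_3)
  next
    assume "\<exists>p \<in> {1..m}. \<exists>q \<in> {1..l}. \<exists>r \<in> {1..l}. y p = x q + x r"
    then obtain p q r where "p \<in> {1..m}" "q \<in> {1..l}" "r \<in> {1..l}" "y p = x q + x r"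
      by blast
    then have "- int (y p) \<in> Y" "int (x q) \<in> X" "int (x r) \<in> X" "sum_list [- int (y p), int (x q), int (x r)] = 0"
      unfolding X_def Y_def by (blast, blast, blast, simp)
    then show "\<exists>T :: (nat, nat \<times> nat) pre_digraph.
        tournament T \<and> card (verts T) = n + 3 \<and> imbalance_set T = X \<union> Y"
      using ext[of "[- int (y p), int (x q), int (x r)]"] by (simp add: numeral_3_eq_3)
  qed
qed

end
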